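(* Let $\mathbf n$ be a sequence with gaps. Then: (i) If $\mathbf n$ has arbitrarily large additive gaps, there is a Banach space $\mathbb X$ with a Markushevich basis $\mathcal B$ that is $\mathbf n$-superdemocratic but not democratic. (ii) If $\mathbf n$ has $l$-bounded additive gaps and $\mathcal B$ is a $\Delta_{sd}$-$\mathbf n$-superdemocratic basis, it is $\mathbf C$-superdemocratic with $\mathbf C\le\max\{n_1\alpha_1\alpha_2,\ \Delta_{sd}(1+l\alpha_1\alpha_2)+l\alpha_1\alpha_2\}$. (iii) If $\mathbf n$ has $l$-bounded additive gaps and $\mathcal B$ is a $\Delta_d$-$\mathbf n$-democratic basis, it is $\mathbf C$-democratic with $\mathbf C\le\max\{(n_1-1)\alpha_1\alpha_2,\ \Delta_d(1+l\alpha_1\alpha_2)+l\alpha_1\alpha_2\}$.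
   Context: Banach spaces $\mathbb X$ are separable and infinite-dimensional over $\mathbb F=\mathbb R$ or $\mathbb C$, with dual $\mathbb X^*$. A basis of $\mathbb X$ is a sequence $\mathcal B=(\mathbf e_i)_{i\in\mathbb N}\subset\mathbb X$ with closed linear span $\mathbb X$, having a (unique) sequence of biorthogonal functionals $(\mathbf e_i^* )_{i\in\mathbb N}\subset\mathbb X^*$ ($\mathbf e_k^*(\mathbf e_i)=\delta_{k,i}$), with $0<\inf_i\min\{\|\mathbf e_i\|,\|\mathbf e_i^*\|\}\le\sup_i\max\{\|\mathbf e_i\|,\|\mathbf e_i^*\|\}<\infty$. Put $\alpha_1=\sup_i\|\mathbf e_i\|$, $\alpha_2=\sup_i\|\mathbf e_i^*\|$. It is a Markushevich basis if, in addition, $\mathbf e_i^*(x)=0$ for all $i$ implies $x=0$. A sequence with gaps is a strictly increasing sequence $\mathbf n=(n_k)_{k\in\mathbb N}$ of positive integers (for convenience $\mathbf n=\mathbb N$ is also allowed), also regarded as a subset of $\mathbb N$. It has arbitrarily large additive gaps if $\limsup_k(n_{k+1}-n_k)=\infty$; for an integer $l\ge2$ it has $l$-bounded additive gaps if $n_{k+1}-n_k\le l$ for all $k$. For a finite $A\subset\mathbb N$, $\Psi_A$ is the set of families $\varepsilon=(\varepsilon_n)_{n\in A}\subset\mathbb F$ with $|\varepsilon_n|=1$, $\mathbf 1_{\varepsilon A}=\sum_{n\in A}\varepsilon_n\mathbf e_n$ and $\mathbf 1_A=\sum_{n\in A}\mathbf e_n$. $\mathcal B$ is $\mathbf n$-superdemocratic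 if there is $\mathbf C>0$ with $\|\mathbf 1_{\varepsilon A}\|\le\mathbf C\|\mathbf 1_{\varepsilon'B}\|$ for all $A,B\subset\mathbb N$ with $|A|\le|B|$, $|A|,|B|\in\mathbf n$, and all $\varepsilon\in\Psi_A$, $\varepsilon'\in\Psi_B$; it is $\Delta_{sd}$-$\mathbf n$-superdemocratic if $\Delta_{sd}$ is the smallest such constant. $\mathcal B$ is $\Delta_d$-$\mathbf n$-democratic if $\Delta_d$ is the smallest constant for which the inequality holds with $\varepsilon\equiv\varepsilon'\equiv1$. The prefix $\mathbf n$ is omitted when $\mathbf n=\mathbb N$. *)

theory Defs
  imports "HOL-Analysis.Analysis"
begin

text \<open>The library has this instance for a metric domain only; \<^typ>\<open>nat\<close> is merely a topological
  space. It makes \<open>nat \<Rightarrow>\<^sub>C 'k\<close>, the space \<open>\<ell>\<^sub>\<infinity>\<close> of bounded sequences with the supremum norm, a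
  Banach space.\<close>

instance bcontfun :: (topological_space, complete_space) complete_space
proof
  fix f :: "nat \<Rightarrow> ('a, 'b) bcontfun"
  assume "Cauchy f"
  then obtain g where "uniform_limit UNIV f g sequentially"
    using uniformly_convergent_eq_cauchy[of "\<lambda>_. True" f]
    unfolding Cauchy_def uniform_limit_sequentially_iff
    by (metis dist_fun_lt_imp_dist_val_lt)
  from uniform_limit_bcontfunE[OF this sequentially_bot]
  obtain l' where "g = apply_bcontfun l'" "f \<longlonglongrightarrow> l'" by metis
  then show "convergent f"
    by (intro convergentI)
qed

instance bcontfun :: (topological_space, banach) banach ..

text \<open>
  The class \<^class>\<open>banach\<close> carries real scalars only. To treat \<open>\<real>\<close> and \<open>\<complex>\<close> uniformly, the
  scalar multiplication \<open>sc\<close> is explicit, over a normed field \<open>'k\<close> which is instantiated to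
  \<^typ>\<open>real\<close> or \<^typ>\<open>complex\<close> in use; for \<open>'k = real\<close> the axioms force \<open>sc\<close> to be \<^const>\<open>scaleR\<close>.
\<close>

locale normed_scaling = vector_space sc
  for sc :: "'k::real_normed_field \<Rightarrow> 'a::real_normed_vector \<Rightarrow> 'a" +
  assumes sc_of_real: "sc (of_real r) x = r *\<^sub>R x"
    and norm_sc: "norm (sc c x) = norm c * norm x"

text \<open>
  A Banach space is a closed subspace \<open>X\<close> of an ambient Banach space, which may be \<open>X\<close> itself
  (\<open>X = UNIV\<close>). The carrier is a set because HOL cannot quantify existentially over types;
  existence is stated with \<open>X \<subseteq> \<ell>\<^sub>\<infinity>\<close>, into which every separable Banach space embeds isometrically.
\<close>

definition banach_space_over ::
    "('k::real_normed_field \<Rightarrow> 'a::banach \<Rightarrow> 'a) \<Rightarrow> 'a set \<Rightarrow> bool" where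
  "banach_space_over sc X \<longleftrightarrow>
     normed_scaling sc \<and> module.subspace sc X \<and> closed X \<and>
     separable_space (top_of_set X) \<and>
     \<not> (\<exists>F. finite F \<and> X \<subseteq> module.span sc F)"

text \<open>
  Functionals on \<open>X\<close> are functions on the whole type of which only the values on \<open>X\<close> matter;
  \<open>dual_norm\<close> is \<^const>\<open>onorm\<close> relativised to \<open>X\<close>.
\<close>

definition in_dual ::
    "('k::real_normed_field \<Rightarrow> 'a::banach \<Rightarrow> 'a) \<Rightarrow> 'a set \<Rightarrow> ('a \<Rightarrow> 'k) \<Rightarrow> bool" where
  "in_dual sc X f \<longleftrightarrow>
     (\<forall>x\<in>X. \<forall>y\<in>X. f (x + y) = f x + f y) \<and>
     (\<forall>c. \<forall>x\<in>X. f (sc c x) = c * f x) \<and>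
     (\<exists>K. \<forall>x\<in>X. norm (f x) \<le> K * norm x)"

definition dual_norm :: "'a::banach set \<Rightarrow> ('a \<Rightarrow> 'k::real_normed_field) \<Rightarrow> real" where
  "dual_norm X f = (SUP x\<in>X. norm (f x) / norm x)"

text \<open>The biorthogonal functionals \<open>es\<close> are an explicit argument; density of the span of \<open>e\<close>
  determines them uniquely on \<open>X\<close>.\<close>

definition basis ::
    "('k::real_normed_field \<Rightarrow> 'a::banach \<Rightarrow> 'a) \<Rightarrow> 'a set \<Rightarrow> (nat \<Rightarrow> 'a) \<Rightarrow> (nat \<Rightarrow> 'a \<Rightarrow> 'k) \<Rightarrow> bool" where
  "basis sc X e es \<longleftrightarrow>
     closure (module.span sc (range e)) = X \<and>
     (\<forall>i. in_dual sc X (es i)) \<and>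
     (\<forall>k i. es k (e i) = (if k = i then 1 else 0)) \<and>
     0 < (INF i. min (norm (e i)) (dual_norm X (es i))) \<and>
     bdd_above (range (\<lambda>i. max (norm (e i)) (dual_norm X (es i))))"

definition markushevich_basis ::
    "('k::real_normed_field \<Rightarrow> 'a::banach \<Rightarrow> 'a) \<Rightarrow> 'a set \<Rightarrow> (nat \<Rightarrow> 'a) \<Rightarrow> (nat \<Rightarrow> 'a \<Rightarrow> 'k) \<Rightarrow> bool" where
  "markushevich_basis sc X e es \<longleftrightarrow>
     basis sc X e es \<and> (\<forall>x\<in>X. (\<forall>i. es i x = 0) \<longrightarrow> x = 0)"

definition alpha1 :: "(nat \<Rightarrow> 'a::banach) \<Rightarrow> real" where
  "alpha1 e = (SUP i. norm (e i))"

definition alpha2 :: "'a::banach set \<Rightarrow> (nat \<Rightarrow> 'a \<Rightarrow> 'k::real_normed_field) \<Rightarrow> real" where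
  "alpha2 X es = (SUP i. dual_norm X (es i))"

text \<open>Sequences are indexed from 0, so the mathematical \<open>n\<^sub>1\<close> is \<open>n 0\<close>. As a subset
  of the positive integers, the sequence is \<open>range n\<close>; the full set is \<open>{1..}\<close>.\<close>

definition sequence_with_gaps :: "(nat \<Rightarrow> nat) \<Rightarrow> bool" where
  "sequence_with_gaps n \<longleftrightarrow> strict_mono n \<and> (\<forall>k. 0 < n k)"

definition arbitrarily_large_additive_gaps :: "(nat \<Rightarrow> nat) \<Rightarrow> bool" where
  "arbitrarily_large_additive_gaps n \<longleftrightarrow>
     limsup (\<lambda>k. ereal (real (n (Suc k)) - real (n k))) = \<infinity>"

definition bounded_additive_gaps :: "nat \<Rightarrow> (nat \<Rightarrow> nat) \<Rightarrow> bool" where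
  "bounded_additive_gaps l n \<longleftrightarrow> (\<forall>k. real (n (Suc k)) - real (n k) \<le> real l)"

definition unimodular_on :: "nat set \<Rightarrow> (nat \<Rightarrow> 'k::real_normed_field) set" where
  "unimodular_on A = {\<epsilon>. \<forall>i\<in>A. norm (\<epsilon> i) = 1}"

definition signed_indicator ::
    "('k::real_normed_field \<Rightarrow> 'a::banach \<Rightarrow> 'a) \<Rightarrow> (nat \<Rightarrow> 'a) \<Rightarrow> (nat \<Rightarrow> 'k) \<Rightarrow> nat set \<Rightarrow> 'a" where
  "signed_indicator sc e \<epsilon> A = (\<Sum>i\<in>A. sc (\<epsilon> i) (e i))"

text \<open>\<open>N\<close> is the set of admissible cardinalities.\<close>

definition superdemocratic_with ::
    "('k::real_normed_field \<Rightarrow> 'a::banach \<Rightarrow> 'a) \<Rightarrow> (nat \<Rightarrow> 'a) \<Rightarrow> nat set \<Rightarrow> real \<Rightarrow> bool" where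
  "superdemocratic_with sc e N C \<longleftrightarrow> 0 < C \<and>
     (\<forall>A B. finite A \<longrightarrow> finite B \<longrightarrow> card A \<le> card B \<longrightarrow> card A \<in> N \<longrightarrow> card B \<in> N \<longrightarrow>
       (\<forall>\<epsilon>\<in>unimodular_on A. \<forall>\<epsilon>'\<in>unimodular_on B.
          norm (signed_indicator sc e \<epsilon> A) \<le> C * norm (signed_indicator sc e \<epsilon>' B)))"

definition democratic_with :: "(nat \<Rightarrow> 'a::banach) \<Rightarrow> nat set \<Rightarrow> real \<Rightarrow> bool" where
  "democratic_with e N C \<longleftrightarrow> 0 < C \<and>
     (\<forall>A B. finite A \<longrightarrow> finite B \<longrightarrow> card A \<le> card B \<longrightarrow> card A \<in> N \<longrightarrow> card B \<in> N \<longrightarrow>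
       norm (\<Sum>i\<in>A. e i) \<le> C * norm (\<Sum>i\<in>B. e i))"

definition superdemocratic ::
    "('k::real_normed_field \<Rightarrow> 'a::banach \<Rightarrow> 'a) \<Rightarrow> (nat \<Rightarrow> 'a) \<Rightarrow> nat set \<Rightarrow> bool" where
  "superdemocratic sc e N \<longleftrightarrow> (\<exists>C. superdemocratic_with sc e N C)"

definition democratic :: "(nat \<Rightarrow> 'a::banach) \<Rightarrow> nat set \<Rightarrow> bool" where
  "democratic e N \<longleftrightarrow> (\<exists>C. democratic_with e N C)"

definition const_superdemocratic ::
    "real \<Rightarrow> ('k::real_normed_field \<Rightarrow> 'a::banach \<Rightarrow> 'a) \<Rightarrow> (nat \<Rightarrow> 'a) \<Rightarrow> nat set \<Rightarrow> bool" where
  "const_superdemocratic D sc e N \<longleftrightarrow>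
     superdemocratic_with sc e N D \<and> (\<forall>C. superdemocratic_with sc e N C \<longrightarrow> D \<le> C)"

definition const_democratic :: "real \<Rightarrow> (nat \<Rightarrow> 'a::banach) \<Rightarrow> nat set \<Rightarrow> bool" where
  "const_democratic D e N \<longleftrightarrow>
     democratic_with e N D \<and> (\<forall>C. democratic_with e N C \<longrightarrow> D \<le> C)"

end

theory Submission
  imports Defs
begin

text \<open>
  If the gaps of \<open>n\<close> are bounded, a finite set \<open>A\<close> of size at least \<open>n\<^sub>1\<close> has a subset of admissible
  size missing at most \<open>l\<close> of its points, so passing to that subset changes \<open>\<one>\<^bsub>\<epsilon>A\<^esub>\<close> by at most
  \<open>l \<alpha>\<^sub>1\<close> in norm. A coordinate functional bounds the norm of any nonempty \<open>\<one>\<^bsub>\<epsilon>B\<^esub>\<close> below by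
  \<open>1 / \<alpha>\<^sub>2\<close>, so such an error is at most \<open>l \<alpha>\<^sub>1 \<alpha>\<^sub>2\<close> times that norm. Sets smaller than \<open>n\<^sub>1\<close> are
  handled by the triangle inequality alone. The argument (\<open>democratic_for_all_sizes\<close>) is the same
  with all signs and with constant signs. The set of admissible constants contains its infimum
  (\<open>least_democratic_constant\<close>).

  If the gaps are unbounded, choose numbers \<open>m\<^sub>j\<close> at distance at least \<open>h\<^sub>j\<close> from all terms of
  \<open>n\<close>, with \<open>h\<^sub>j\<close> growing fast enough, where \<open>m\<^sub>0 = 0\<close>, \<open>h\<^sub>0 = 1\<close> and \<open>m\<^sub>j \<ge> h\<^sub>j\<close> for \<open>j > 0\<close>. With \<open>I\<^sub>j = {0, ..., m\<^sub>j - 1}\<close>, take the completion of the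
  finitely supported sequences under the norm
  \[ \|x\| = \sup_{j, S, T} \frac{j!}{h_j} \Bigl| \sum_{i \in S} x_i - \sum_{i \in T} x_i \Bigr|,
     \qquad |S|, |T| \le h_j, \quad |S \cap I_j| = |T \cap I_j| . \]
  The last constraint makes the functionals at level \<open>j\<close> vanish on \<open>\<one>\<^bsub>I\<^sub>j\<^esub>\<close>, so only the other levels
  count. For \<open>j > 0\<close> the vector \<open>\<one>\<^bsub>I\<^sub>j\<^esub>\<close> has norm at most \<open>2 (j-1)!\<close>, whereas a set of the same size disjoint from
  \<open>I\<^sub>j\<close> has norm at least \<open>j!\<close>: the basis is not democratic. But the constraint costs only a constant
  factor on a set \<open>A\<close> whose size is a term of \<open>n\<close>. Such a size differs from \<open>m\<^sub>j\<close> by at least \<open>h\<^sub>j\<close>,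
  so either \<open>A\<close> has \<open>h\<^sub>j\<close> points outside \<open>I\<^sub>j\<close>, or \<open>I\<^sub>j\<close> has \<open>h\<^sub>j\<close> points outside \<open>A\<close>, which can be put
  in \<open>T\<close> to balance a subset \<open>S\<close> of \<open>A\<close> (\<open>weight_min_le_norm\<close>). Hence \<open>\<parallel>\<one>\<^bsub>\<epsilon>A\<^esub>\<parallel>\<close> is
  equivalent to \<open>sup\<^sub>j j! min(|A|, h\<^sub>j) / h\<^sub>j\<close>, which is increasing in \<open>|A|\<close>, and the basis is
  \<open>n\<close>-superdemocratic. The family of functionals is countable, so listing their
  values embeds the space in \<open>\<ell>\<^sub>\<infinity>\<close>; the functionals at level \<open>0\<close> include the coordinates, and all
  others are finite combinations of them, which is why the basis is a Markushevich basis.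
\<close>

section \<open>Norms of functionals\<close>

lemma dual_norm_bounds:
  assumes "in_dual sc X f" and "x \<in> X"
  shows "norm (f x) \<le> dual_norm X f * norm x"
    and "norm (f x) / norm x \<le> dual_norm X f"
proof -
  obtain K where K: "\<And>x. x \<in> X \<Longrightarrow> norm (f x) \<le> K * norm x"
    using assms(1) unfolding in_dual_def by blast
  have "norm (f y) / norm y \<le> \<bar>K\<bar>" if "y \<in> X" for y
    using K[OF that] abs_ge_self[of K]
    by (cases "y = 0") (auto simp: divide_simps intro: order_trans mult_right_mono)
  hence "bdd_above ((\<lambda>y. norm (f y) / norm y) ` X)"
    by (auto intro!: bdd_aboveI)
  thus le: "norm (f x) / norm x \<le> dual_norm X f"
    unfolding dual_norm_def using assms(2) by (rule cSUP_upper2) auto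
  show "norm (f x) \<le> dual_norm X f * norm x"
    using le K[OF assms(2)] by (cases "x = 0") (auto simp: divide_simps)
qed

section \<open>Bounded gaps\<close>

text \<open>
  Democracy with the signs on \<open>A\<close> restricted to \<open>P A\<close>: all unimodular families give superdemocracy,
  the constant family \<open>1\<close> gives democracy.
\<close>
definition democratic_for ::
    "('k::real_normed_field \<Rightarrow> 'a::banach \<Rightarrow> 'a) \<Rightarrow> (nat \<Rightarrow> 'a) \<Rightarrow> (nat set \<Rightarrow> (nat \<Rightarrow> 'k) set) \<Rightarrow>
      nat set \<Rightarrow> real \<Rightarrow> bool" where
  "democratic_for sc e P N C \<longleftrightarrow> 0 < C \<and>
     (\<forall>A B. finite A \<longrightarrow> finite B \<longrightarrow> card A \<le> card B \<longrightarrow> card A \<in> N \<longrightarrow> card B \<in> N \<longrightarrow>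
       (\<forall>\<epsilon>\<in>P A. \<forall>\<epsilon>'\<in>P B.
          norm (signed_indicator sc e \<epsilon> A) \<le> C * norm (signed_indicator sc e \<epsilon>' B)))"

lemma unimodular_on_antimono: "A' \<subseteq> A \<Longrightarrow> unimodular_on A \<subseteq> unimodular_on A'"
  by (auto simp: unimodular_on_def)

lemma superdemocratic_with_eq:
  "superdemocratic_with sc e N C \<longleftrightarrow> democratic_for sc e unimodular_on N C"
  unfolding superdemocratic_with_def democratic_for_def ..

text \<open>
  The witness is the largest index \<open>k\<close> with \<open>n k \<le> q\<close>: then \<open>q\<close> lies before the next term, which is
  at most \<open>l\<close> away.
\<close>
lemma last_term_before:
  assumes n: "strict_mono n" and gaps: "bounded_additive_gaps l n" and "n 0 \<le> q"
  obtains k where "n k \<le> q" "q \<le> n k + l"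
proof -
  have "\<exists>k. n k \<le> q \<and> q < n (Suc k)"
    using \<open>n 0 \<le> q\<close>
  proof (induction q rule: dec_induct)
    case base
    thus ?case using n by (auto simp: strict_mono_Suc_iff)
  next
    case (step q)
    then obtain k where k: "n k \<le> q" "q < n (Suc k)" by blast
    show ?case
    proof (cases "Suc q < n (Suc k)")
      case True
      thus ?thesis using k by (intro exI[of _ k]) auto
    next
      case False
      hence "Suc q = n (Suc k)" using k by simp
      thus ?thesis using n by (intro exI[of _ "Suc k"]) (auto simp: strict_mono_Suc_iff)
    qed
  qed
  then obtain k where k: "n k \<le> q" "q < n (Suc k)" by blast
  have "real (n (Suc k)) - real (n k) \<le> real l"
    using gaps by (auto simp: bounded_additive_gaps_def)
  hence "q \<le> n k + l" using k by linarith
  thus thesis using k that by blast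
qed

context
  fixes sc :: "'k::real_normed_field \<Rightarrow> 'a::banach \<Rightarrow> 'a" and X :: "'a set"
    and e :: "nat \<Rightarrow> 'a" and es :: "nat \<Rightarrow> 'a \<Rightarrow> 'k"
  assumes space: "banach_space_over sc X" and basis: "basis sc X e es"
begin

interpretation normed_scaling sc
  using space by (simp add: banach_space_over_def)

lemma norm_basis_le: "norm (e i) \<le> alpha1 e"
proof -
  have "bdd_above (range (\<lambda>i. max (norm (e i)) (dual_norm X (es i))))"
    using basis by (simp add: basis_def)
  then obtain M where "\<And>i. max (norm (e i)) (dual_norm X (es i)) \<le> M"
    unfolding bdd_above_def by auto
  hence "bdd_above (range (\<lambda>i. norm (e i)))"
    by (intro bdd_aboveI[of _ M]) auto
  thus ?thesis unfolding alpha1_def by (intro cSUP_upper) auto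
qed

lemma dual_norm_basis_le: "dual_norm X (es i) \<le> alpha2 X es"
proof -
  have "bdd_above (range (\<lambda>i. max (norm (e i)) (dual_norm X (es i))))"
    using basis by (simp add: basis_def)
  then obtain M where "\<And>i. max (norm (e i)) (dual_norm X (es i)) \<le> M"
    unfolding bdd_above_def by auto
  hence "bdd_above (range (\<lambda>i. dual_norm X (es i)))"
    by (intro bdd_aboveI[of _ M]) auto
  thus ?thesis unfolding alpha2_def by (intro cSUP_upper) auto
qed

lemma coordinate_le:
  assumes "x \<in> X"
  shows "norm (es i x) \<le> alpha2 X es * norm x"
proof -
  have "norm (es i x) \<le> dual_norm X (es i) * norm x"
    using dual_norm_bounds(1)[of sc X "es i" x] basis assms by (simp add: basis_def)
  also have "\<dots> \<le> alpha2 X es * norm x"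
    by (intro mult_right_mono dual_norm_basis_le) auto
  finally show ?thesis .
qed

lemma subspace_X: "subspace X"
  using space by (simp add: banach_space_over_def)

lemma basis_in_X: "e i \<in> X"
proof -
  have "e i \<in> span (range e)" by (rule span_base) simp
  thus ?thesis using basis closure_subset unfolding basis_def by blast
qed

lemma alpha_nonneg: "0 \<le> alpha1 e" "0 \<le> alpha2 X es"
proof -
  show "0 \<le> alpha1 e" using norm_basis_le[of 0] norm_ge_zero order_trans by blast
  have "1 = norm (es 0 (e 0))" using basis by (simp add: basis_def)
  also have "\<dots> \<le> alpha2 X es * norm (e 0)" by (intro coordinate_le basis_in_X)
  finally have "0 < alpha2 X es * norm (e 0)" by linarith
  thus "0 \<le> alpha2 X es" using norm_ge_zero[of "e 0"] by (simp add: zero_less_mult_iff)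
qed

lemma signed_indicator_in_X: "signed_indicator sc e \<epsilon> A \<in> X"
  unfolding signed_indicator_def
  by (intro subspace_sum subspace_X subspace_scale basis_in_X)

lemma coordinate_signed_indicator:
  assumes "finite B" "i \<in> B"
  shows "es i (signed_indicator sc e \<epsilon> B) = \<epsilon> i"
proof -
  have add: "es i (x + y) = es i x + es i y" if "x \<in> X" "y \<in> X" for x y
    using basis that by (simp add: basis_def in_dual_def)
  have scl: "es i (sc c x) = c * es i x" if "x \<in> X" for c x
    using basis that by (simp add: basis_def in_dual_def)
  have "es i 0 = 0" using scl[of "e 0" 0] basis_in_X by simp
  have "es i (signed_indicator sc e \<epsilon> B) = (\<Sum>k\<in>B. \<epsilon> k * es i (e k))"
    using \<open>finite B\<close>
  proof (induction B)
    case empty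
    thus ?case using \<open>es i 0 = 0\<close> by (simp add: signed_indicator_def)
  next
    case (insert k B)
    have "signed_indicator sc e \<epsilon> (insert k B) = sc (\<epsilon> k) (e k) + signed_indicator sc e \<epsilon> B"
      using insert by (simp add: signed_indicator_def)
    thus ?case using insert
      by (simp add: add scl subspace_X subspace_scale basis_in_X signed_indicator_in_X)
  qed
  also have "\<dots> = (\<Sum>k\<in>B. if k = i then \<epsilon> i else 0)"
    by (rule sum.cong) (use basis in \<open>auto simp: basis_def\<close>)
  finally show ?thesis using assms by simp
qed

text \<open>
  A coordinate functional at a point of \<open>B\<close> takes a unimodular value. This is what turns additive
  errors into multiples of the norm.
\<close>
lemma signed_indicator_lower:
  assumes "finite B" "B \<noteq> {}" "\<epsilon> \<in> unimodular_on B"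
  shows "1 \<le> alpha2 X es * norm (signed_indicator sc e \<epsilon> B)"
proof -
  obtain i where i: "i \<in> B" using assms by blast
  have "norm (es i (signed_indicator sc e \<epsilon> B)) \<le> alpha2 X es * norm (signed_indicator sc e \<epsilon> B)"
    by (intro coordinate_le signed_indicator_in_X)
  thus ?thesis
    using coordinate_signed_indicator[OF assms(1) i] assms(3) i by (simp add: unimodular_on_def)
qed

lemma signed_indicator_upper:
  assumes "\<epsilon> \<in> unimodular_on A"
  shows "norm (signed_indicator sc e \<epsilon> A) \<le> real (card A) * alpha1 e"
proof -
  have "norm (signed_indicator sc e \<epsilon> A) \<le> (\<Sum>i\<in>A. norm (sc (\<epsilon> i) (e i)))"
    unfolding signed_indicator_def by (rule norm_sum)
  also have "\<dots> \<le> (\<Sum>i\<in>A. alpha1 e)"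
    by (rule sum_mono) (use assms norm_basis_le in \<open>auto simp: norm_sc unimodular_on_def\<close>)
  finally show ?thesis by simp
qed

lemma signed_indicator_diff:
  assumes "finite A" "A' \<subseteq> A" "\<epsilon> \<in> unimodular_on A" "card A \<le> card A' + l"
  shows "norm (signed_indicator sc e \<epsilon> A - signed_indicator sc e \<epsilon> A') \<le> real l * alpha1 e"
proof -
  have fin: "finite A'" using assms finite_subset by blast
  have "signed_indicator sc e \<epsilon> A - signed_indicator sc e \<epsilon> A' = signed_indicator sc e \<epsilon> (A - A')"
    unfolding signed_indicator_def using assms by (simp add: sum_diff)
  moreover have "\<epsilon> \<in> unimodular_on (A - A')"
    using assms by (auto simp: unimodular_on_def)
  ultimately have "norm (signed_indicator sc e \<epsilon> A - signed_indicator sc e \<epsilon> A')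
      \<le> real (card (A - A')) * alpha1 e"
    using signed_indicator_upper by metis
  also have "\<dots> \<le> real l * alpha1 e"
    using assms fin by (intro mult_right_mono alpha_nonneg) (auto simp: card_Diff_subset)
  finally show ?thesis .
qed

text \<open>
  For \<open>|A| < n 0\<close> the triangle inequality gives the first constant. Otherwise trim \<open>A\<close> and \<open>B\<close> to
  admissible sizes, compare the trimmed sets with \<open>\<Delta>\<close>, and absorb the two trimming errors, each at
  most \<open>l \<alpha>\<^sub>1\<close>, with \<open>signed_indicator_lower\<close>.
\<close>
lemma democratic_for_all_sizes:
  assumes n: "strict_mono n" and gaps: "bounded_additive_gaps l n"
    and unimod: "\<And>A. P A \<subseteq> unimodular_on A"
    and antimono: "\<And>A A'. A' \<subseteq> A \<Longrightarrow> P A \<subseteq> P A'"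
    and dem: "democratic_for sc e P (range n) \<Delta>"
  shows "democratic_for sc e P {1..}
    (max ((real (n 0) - 1) * alpha1 e * alpha2 X es)
      (\<Delta> * (1 + real l * alpha1 e * alpha2 X es) + real l * alpha1 e * alpha2 X es))"
    (is "democratic_for _ _ _ _ (max ?C1 ?C2)")
  unfolding democratic_for_def
proof (intro conjI allI impI ballI)
  let ?a1 = "alpha1 e" and ?a2 = "alpha2 X es"
  have a: "0 \<le> ?a1" "0 \<le> ?a2" by (fact alpha_nonneg)+
  have \<Delta>: "0 < \<Delta>" using dem by (simp add: democratic_for_def)
  have "0 < \<Delta> * (1 + real l * ?a1 * ?a2)"
    using \<Delta> a by (intro mult_pos_pos add_pos_nonneg mult_nonneg_nonneg) auto
  moreover have "0 \<le> real l * ?a1 * ?a2" using a by simp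
  ultimately show "0 < max ?C1 ?C2" by simp
  fix A B \<epsilon> \<epsilon>'
  assume fin: "finite A" "finite B" and le: "card A \<le> card B"
    and "card A \<in> {1..}" "card B \<in> {1..}" and \<epsilon>: "\<epsilon> \<in> P A" and \<epsilon>': "\<epsilon>' \<in> P B"
  hence ne: "B \<noteq> {}" by auto
  define x where "x = signed_indicator sc e \<epsilon> A"
  define y where "y = signed_indicator sc e \<epsilon>' B"
  have y: "1 \<le> ?a2 * norm y"
    unfolding y_def using signed_indicator_lower[OF fin(2) ne] \<epsilon>' unimod by blast
  have absorb: "t * ?a1 \<le> t * ?a1 * ?a2 * norm y" if "0 \<le> t" for t
    using mult_left_mono[OF y, of "t * ?a1"] that a by (simp add: mult_ac)
  show "norm (signed_indicator sc e \<epsilon> A) \<le> max ?C1 ?C2 * norm (signed_indicator sc e \<epsilon>' B)"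
    unfolding x_def[symmetric] y_def[symmetric]
  proof (cases "card A < n 0")
    case True
    have "norm x \<le> real (card A) * ?a1"
      unfolding x_def using signed_indicator_upper \<epsilon> unimod by blast
    also have "\<dots> \<le> (real (n 0) - 1) * ?a1"
      using True a by (intro mult_right_mono) auto
    also have "\<dots> \<le> ?C1 * norm y" using True by (intro absorb) auto
    also have "\<dots> \<le> max ?C1 ?C2 * norm y" by (intro mult_right_mono) auto
    finally show "norm x \<le> max ?C1 ?C2 * norm y" .
  next
    case False
    obtain j where j: "n j \<le> card A" "card A \<le> n j + l"
      using last_term_before[OF n gaps, of "card A"] False by auto
    obtain k where k: "n k \<le> card B" "card B \<le> n k + l"
      using last_term_before[OF n gaps, of "card B"] False le by auto
    \<comment> \<open>The minimum guarantees \<open>card A' \<le> card B'\<close>. It keeps \<open>A'\<close> within \<open>l\<close> points of \<open>A\<close>: if \<open>k < j\<close>,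
      then \<open>n k \<le> card A \<le> card B \<le> n k + l\<close>.\<close>
    obtain A' where A': "A' \<subseteq> A" "card A' = n (min j k)"
    proof -
      have "n (min j k) \<le> n j" using n by (simp add: strict_mono_less_eq)
      thus thesis using that j obtain_subset_with_card_n order_trans by metis
    qed
    obtain B' where B': "B' \<subseteq> B" "card B' = n k"
      using k obtain_subset_with_card_n by metis
    have "card A \<le> card A' + l" using A' j k le by (cases "j \<le> k") (auto simp: min_def)
    have fin': "finite A'" "finite B'" using A' B' fin finite_subset by blast+
    define x' where "x' = signed_indicator sc e \<epsilon> A'"
    define y' where "y' = signed_indicator sc e \<epsilon>' B'"
    have "norm (x - x') \<le> real l * ?a1"
      unfolding x_def x'_def using \<epsilon> unimod \<open>card A \<le> card A' + l\<close>
      by (intro signed_indicator_diff fin A') auto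
    hence xx': "norm x \<le> norm x' + real l * ?a1"
      using norm_triangle_sub[of x x'] by linarith
    have "norm (y - y') \<le> real l * ?a1"
      unfolding y_def y'_def using \<epsilon>' unimod k B' by (intro signed_indicator_diff fin B') auto
    hence yy': "norm y' \<le> norm y + real l * ?a1"
      using norm_triangle_sub[of y' y] norm_minus_commute[of y y'] by linarith
    have "card A' \<le> card B'" using A' B' n by (simp add: strict_mono_less_eq)
    moreover have "\<epsilon> \<in> P A'" "\<epsilon>' \<in> P B'" using \<epsilon> \<epsilon>' antimono A' B' by blast+
    ultimately have "norm x' \<le> \<Delta> * norm y'"
      using dem fin' A' B' unfolding democratic_for_def x'_def y'_def by auto
    also have "\<dots> \<le> \<Delta> * (norm y + real l * ?a1)"
      using yy' \<Delta> by (intro mult_left_mono) auto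
    finally have "norm x \<le> \<Delta> * (norm y + real l * ?a1) + real l * ?a1" using xx' by linarith
    also have "\<dots> \<le> \<Delta> * (norm y + real l * ?a1 * ?a2 * norm y) + real l * ?a1 * ?a2 * norm y"
      using \<Delta> by (intro add_mono mult_left_mono absorb order_refl) auto
    also have "\<dots> = ?C2 * norm y" by (simp add: algebra_simps)
    also have "\<dots> \<le> max ?C1 ?C2 * norm y" by (intro mult_right_mono) auto
    finally show "norm x \<le> max ?C1 ?C2 * norm y" .
  qed
qed

text \<open>
  The infimum of the constants is positive, being at least \<open>1\<close> (compare a singleton with itself), and
  it is again a constant since each of the defining inequalities is preserved by limits.
\<close>
lemma least_democratic_constant:
  assumes "democratic_for sc e P N C0" "\<And>A. (\<lambda>_. 1) \<in> P A" "1 \<in> N"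
  obtains C where "democratic_for sc e P N C" "C \<le> C0"
    "\<And>C'. democratic_for sc e P N C' \<Longrightarrow> C \<le> C'"
proof -
  define S where "S = {C. democratic_for sc e P N C}"
  have "e 0 \<noteq> 0" using signed_indicator_lower[of "{0}" "\<lambda>_. 1"]
    by (auto simp: unimodular_on_def signed_indicator_def)
  have ge1: "1 \<le> C" if "C \<in> S" for C
  proof -
    have "norm (signed_indicator sc e (\<lambda>_. 1) {0}) \<le> C * norm (signed_indicator sc e (\<lambda>_. 1) {0})"
      using that assms unfolding S_def democratic_for_def by auto
    thus ?thesis using \<open>e 0 \<noteq> 0\<close> by (simp add: signed_indicator_def)
  qed
  have bdd: "bdd_below S" using ge1 by (rule bdd_belowI)
  have ne: "S \<noteq> {}" using assms by (auto simp: S_def)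
  have lower: "Inf S \<le> C" if "C \<in> S" for C using that bdd by (rule cInf_lower)
  have "democratic_for sc e P N (Inf S)"
    unfolding democratic_for_def
  proof (intro conjI allI impI ballI)
    show "0 < Inf S" using cInf_greatest[OF ne ge1] by linarith
    fix A B \<epsilon> \<epsilon>'
    assume *: "finite A" "finite B" "card A \<le> card B" "card A \<in> N" "card B \<in> N" "\<epsilon> \<in> P A" "\<epsilon>' \<in> P B"
    let ?x = "norm (signed_indicator sc e \<epsilon> A)" and ?y = "norm (signed_indicator sc e \<epsilon>' B)"
    have ineq: "?x \<le> C * ?y" if "C \<in> S" for C
      using that * unfolding S_def democratic_for_def by blast
    show "?x \<le> Inf S * ?y"
    proof (cases "?y = 0")
      case True
      thus ?thesis using ineq ne by fastforce
    next
      case False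
      hence y: "0 < ?y" by simp
      have "?x / ?y \<le> Inf S"
        by (rule cInf_greatest[OF ne]) (use ineq y in \<open>simp add: pos_divide_le_eq\<close>)
      thus ?thesis using y by (simp add: pos_divide_le_eq)
    qed
  qed
  thus thesis using that lower assms by (auto simp: S_def)
qed

lemma superdemocratic_of_bounded_gaps:
  assumes n: "sequence_with_gaps n" and gaps: "bounded_additive_gaps l n"
    and dem: "const_superdemocratic \<Delta> sc e (range n)"
  shows "\<exists>C. const_superdemocratic C sc e {1..} \<and>
    C \<le> max (real (n 0) * alpha1 e * alpha2 X es)
          (\<Delta> * (1 + real l * alpha1 e * alpha2 X es) + real l * alpha1 e * alpha2 X es)"
    (is "\<exists>C. _ \<and> C \<le> max ?C0 ?C2")
proof -
  have "democratic_for sc e unimodular_on {1..}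
      (max ((real (n 0) - 1) * alpha1 e * alpha2 X es) ?C2)"
    using n gaps dem
    by (intro democratic_for_all_sizes unimodular_on_antimono)
       (auto simp: sequence_with_gaps_def const_superdemocratic_def superdemocratic_with_eq)
  then obtain C where C: "democratic_for sc e unimodular_on {1..} C"
    "C \<le> max ((real (n 0) - 1) * alpha1 e * alpha2 X es) ?C2"
    "\<And>C'. democratic_for sc e unimodular_on {1..} C' \<Longrightarrow> C \<le> C'"
    by (rule least_democratic_constant) (auto simp: unimodular_on_def)
  have "(real (n 0) - 1) * alpha1 e * alpha2 X es \<le> ?C0"
    using alpha_nonneg by (intro mult_right_mono) auto
  hence "C \<le> max ?C0 ?C2" using C(2) by linarith
  thus ?thesis using C by (auto simp: const_superdemocratic_def superdemocratic_with_eq)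
qed

lemma democratic_of_bounded_gaps:
  assumes n: "sequence_with_gaps n" and gaps: "bounded_additive_gaps l n"
    and dem: "const_democratic \<Delta> e (range n)"
  shows "\<exists>C. const_democratic C e {1..} \<and>
    C \<le> max ((real (n 0) - 1) * alpha1 e * alpha2 X es)
          (\<Delta> * (1 + real l * alpha1 e * alpha2 X es) + real l * alpha1 e * alpha2 X es)"
    (is "\<exists>C. _ \<and> C \<le> ?C0")
proof -
  have eq: "democratic_with e N C \<longleftrightarrow> democratic_for sc e (\<lambda>_. {\<lambda>_. 1}) N C" for N C
    by (simp add: democratic_with_def democratic_for_def signed_indicator_def)
  have "democratic_for sc e (\<lambda>_. {\<lambda>_. 1}) {1..} ?C0"
    using n gaps dem
    by (intro democratic_for_all_sizes)
       (auto simp: sequence_with_gaps_def const_democratic_def eq unimodular_on_def)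
  then obtain C where C: "democratic_for sc e (\<lambda>_. {\<lambda>_. 1}) {1..} C" "C \<le> ?C0"
    "\<And>C'. democratic_for sc e (\<lambda>_. {\<lambda>_. 1}) {1..} C' \<Longrightarrow> C \<le> C'"
    by (rule least_democratic_constant) auto
  thus ?thesis by (auto simp: const_democratic_def eq)
qed

end

section \<open>Scaling and subspaces of the space of bounded functions\<close>

lemma apply_bcontfun_sum: "apply_bcontfun (sum f A) t = (\<Sum>i\<in>A. apply_bcontfun (f i) t)"
  by (induction A rule: infinite_finite_induct) (simp_all add: zero_bcontfun.rep_eq plus_bcontfun.rep_eq)

lemma continuous_on_evaluation:
  "continuous_on S (\<lambda>x :: 'a::topological_space \<Rightarrow>\<^sub>C 'b::metric_space. apply_bcontfun x t)"
  unfolding continuous_on_iff using dist_bounded le_less_trans by blast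

definition bc_scale ::
    "'k::real_normed_field \<Rightarrow> ('t::topological_space \<Rightarrow>\<^sub>C 'k) \<Rightarrow> ('t \<Rightarrow>\<^sub>C 'k)" where
  "bc_scale c f = Bcontfun (\<lambda>t. c * apply_bcontfun f t)"

lemma apply_bc_scale: "apply_bcontfun (bc_scale c f) t = c * apply_bcontfun f t"
proof -
  have "(\<lambda>t. c * apply_bcontfun f t) \<in> bcontfun"
    by (intro bcontfun_normI[of _ "norm c * norm f"] continuous_intros)
       (auto simp: norm_mult intro: mult_left_mono norm_bounded)
  thus ?thesis by (simp add: bc_scale_def Bcontfun_inverse)
qed

interpretation bc_scale: normed_scaling bc_scale
proof
  show "norm (bc_scale c x) = norm c * norm x" for c :: "'k::real_normed_field" and x :: "'t::topological_space \<Rightarrow>\<^sub>C 'k"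
  proof (rule antisym)
    have le: "norm (bc_scale c x) \<le> norm c * norm x" for c :: 'k and x :: "'t \<Rightarrow>\<^sub>C 'k"
      by (intro norm_bound)
         (auto simp: apply_bc_scale norm_mult intro: mult_left_mono norm_bounded)
    thus "norm (bc_scale c x) \<le> norm c * norm x" .
    have "bc_scale (inverse c) (bc_scale c x) = x" if "c \<noteq> 0"
      using that by (intro bcontfun_eqI) (simp add: apply_bc_scale)
    hence "norm x \<le> norm (inverse c) * norm (bc_scale c x)" if "c \<noteq> 0"
      using le[of "inverse c" "bc_scale c x"] that by simp
    thus "norm c * norm x \<le> norm (bc_scale c x)"
      by (cases "c = 0") (auto simp: norm_divide field_simps)
  qed
qed (auto intro!: bcontfun_eqI simp: apply_bc_scale algebra_simps plus_bcontfun.rep_eq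
      scaleR_bcontfun.rep_eq scaleR_conv_of_real)

text \<open>
  The scalars are those of \<open>sc\<close>, so this covers closed complex subspaces of a space that is normed
  over the reals.
\<close>
lemma (in normed_scaling) subspace_closure:
  assumes "subspace S"
  shows "subspace (closure S)"
proof (rule subspaceI)
  show "0 \<in> closure S" using subspace_0[OF assms] closure_subset by blast
  fix x y c assume x: "x \<in> closure S"
  have "\<exists>s\<in>S. dist s (sc c x) < d" if d: "d > 0" for d
  proof -
    have pos: "0 < d / (norm c + 1)" using d by (simp add: add_nonneg_pos)
    then obtain s where s: "s \<in> S" "dist s x < d / (norm c + 1)"
      using x unfolding closure_approachable by blast
    have "dist (sc c s) (sc c x) = norm c * dist s x"
      by (simp add: dist_norm norm_sc flip: scale_right_diff_distrib)
    also have "\<dots> \<le> (norm c + 1) * dist s x" by (intro mult_right_mono) auto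
    also have "\<dots> < d"
      using s(2) by (subst (asm) pos_less_divide_eq) (auto simp: add_nonneg_pos mult.commute)
    finally show ?thesis using subspace_scale[OF assms s(1)] by blast
  qed
  thus "sc c x \<in> closure S" unfolding closure_approachable by blast
  assume y: "y \<in> closure S"
  have "\<exists>s\<in>S. dist s (x + y) < d" if d: "d > 0" for d
  proof -
    obtain s t where st: "s \<in> S" "dist s x < d/2" "t \<in> S" "dist t y < d/2"
      using x y d unfolding closure_approachable by (meson half_gt_zero)
    have "dist (s + t) (x + y) < d" using st dist_triangle_add[of s t x y] by linarith
    thus ?thesis using subspace_add[OF assms st(1,3)] by blast
  qed
  thus "x + y \<in> closure S" unfolding closure_approachable by blast
qed

text \<open>
  Combinations with coefficients in a countable dense set of scalars are encoded by finite words of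
  pairs of a scalar and an index, of which there are countably many.
\<close>
lemma separable_closure_span:
  fixes sc :: "'k::{real_normed_field, second_countable_topology} \<Rightarrow> 'a::real_normed_vector \<Rightarrow> 'a"
    and e :: "nat \<Rightarrow> 'a"
  assumes "normed_scaling sc"
  shows "separable_space (top_of_set (closure (module.span sc (range e))))"
proof -
  interpret normed_scaling sc by fact
  obtain D :: "'k set" where D: "countable D" "\<And>U. open U \<Longrightarrow> U \<noteq> {} \<Longrightarrow> \<exists>d\<in>D. d \<in> U"
    using countable_dense_setE by blast
  define comb where "comb ws = sum_list (map (\<lambda>(d, i). sc d (e i)) ws)" for ws :: "('k \<times> nat) list"
  define Q where "Q = comb ` lists (D \<times> UNIV)"
  have comb_span: "comb ws \<in> span (range e)" for ws
  proof (induction ws)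
    case Nil
    show ?case by (simp add: comb_def span_zero)
  next
    case (Cons w ws)
    have "sc (fst w) (e (snd w)) \<in> span (range e)" by (intro span_scale span_base) simp
    thus ?case using Cons span_add by (simp add: comb_def case_prod_beta)
  qed
  have QX: "Q \<subseteq> closure (span (range e))"
    unfolding Q_def using comb_span closure_subset by blast
  have "x \<in> closure Q" if "x \<in> span (range e)" for x
    using that
  proof (induction rule: span_induct_alt)
    case base
    have "comb [] \<in> Q" unfolding Q_def by blast
    thus ?case using closure_subset by (auto simp: comb_def)
  next
    case (step c x y)
    obtain i where i: "x = e i" using step by blast
    have "\<exists>q\<in>Q. dist q (sc c x + y) < d" if d: "d > 0" for d
    proof -
      have "0 < d/2" using d by simp
      then obtain q where q: "q \<in> Q" "dist q y < d/2"
        using step.IH unfolding closure_approachable by blast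
      obtain ws where ws: "ws \<in> lists (D \<times> UNIV)" "q = comb ws" using q by (auto simp: Q_def)
      have "0 < d / 2 / (norm x + 1)" using d by (simp add: add_nonneg_pos)
      then obtain b where b: "b \<in> D" "dist b c < d / 2 / (norm x + 1)"
        using D(2)[of "ball c (d / 2 / (norm x + 1))"] by (auto simp: dist_commute)
      have "dist (sc b x) (sc c x) = dist b c * norm x"
        by (simp add: dist_norm norm_sc flip: scale_left_diff_distrib)
      also have "\<dots> \<le> dist b c * (norm x + 1)" by (intro mult_left_mono) auto
      also have "\<dots> < d / 2"
        using b(2) by (subst (asm) pos_less_divide_eq) (auto simp: add_nonneg_pos)
      finally have "dist (sc b x + q) (sc c x + y) < d"
        using q dist_triangle_add[of "sc b x" q "sc c x" y] by linarith
      moreover have "sc b x + q \<in> Q"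
        unfolding Q_def using ws b i
        by (intro image_eqI[of _ _ "(b, i) # ws"]) (auto simp: comb_def)
      ultimately show ?thesis by blast
    qed
    thus ?case unfolding closure_approachable by blast
  qed
  hence "closure (span (range e)) \<subseteq> closure Q"
    by (intro closure_minimal) auto
  moreover have "countable Q" unfolding Q_def using D(1) by (intro countable_image) auto
  ultimately show ?thesis
    unfolding separable_space_def using QX
    by (intro exI[of _ Q]) (auto simp: closure_of_subtopology Int_absorb1)
qed

section \<open>Subsets with a large sum\<close>

text \<open>
  One of the positive part and the negative part carries half of the total mass. Selecting subsets
  thus replaces the choice of signs: functionals with coefficients \<open>0\<close> and \<open>1\<close> are enough to detect
  \<open>\<ell>\<^sub>1\<close> norms up to a factor, over the complex numbers too, and there are only countably many.
\<close>
lemma large_subset_sum_real: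
  fixes \<epsilon> :: "nat \<Rightarrow> real"
  assumes "finite A"
  shows "\<exists>S\<subseteq>A. (\<Sum>i\<in>A. \<bar>\<epsilon> i\<bar>) / 2 \<le> \<bar>sum \<epsilon> S\<bar>"
proof -
  define P where "P = {i\<in>A. 0 \<le> \<epsilon> i}"
  have P: "P \<subseteq> A" by (auto simp: P_def)
  have "(\<Sum>i\<in>A. \<bar>\<epsilon> i\<bar>) = (\<Sum>i\<in>A-P. \<bar>\<epsilon> i\<bar>) + (\<Sum>i\<in>P. \<bar>\<epsilon> i\<bar>)"
    using assms P by (rule sum.subset_diff[rotated])
  also have "(\<Sum>i\<in>P. \<bar>\<epsilon> i\<bar>) = sum \<epsilon> P" by (rule sum.cong) (auto simp: P_def)
  also have "(\<Sum>i\<in>A-P. \<bar>\<epsilon> i\<bar>) = - sum \<epsilon> (A - P)"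
    unfolding sum_negf[symmetric] by (rule sum.cong) (auto simp: P_def)
  finally have "(\<Sum>i\<in>A. \<bar>\<epsilon> i\<bar>) / 2 \<le> \<bar>sum \<epsilon> P\<bar> \<or> (\<Sum>i\<in>A. \<bar>\<epsilon> i\<bar>) / 2 \<le> \<bar>sum \<epsilon> (A - P)\<bar>"
    by (auto simp: abs_if)
  thus ?thesis using P by blast
qed

lemma large_subset_sum_complex:
  fixes \<epsilon> :: "nat \<Rightarrow> complex"
  assumes "finite A"
  shows "\<exists>S\<subseteq>A. (\<Sum>i\<in>A. norm (\<epsilon> i)) / 4 \<le> norm (sum \<epsilon> S)"
proof -
  have "(\<Sum>i\<in>A. norm (\<epsilon> i)) \<le> (\<Sum>i\<in>A. \<bar>Re (\<epsilon> i)\<bar>) + (\<Sum>i\<in>A. \<bar>Im (\<epsilon> i)\<bar>)"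
    unfolding sum.distrib[symmetric] by (intro sum_mono cmod_le)
  moreover obtain S where S: "S \<subseteq> A" "(\<Sum>i\<in>A. \<bar>Re (\<epsilon> i)\<bar>) / 2 \<le> \<bar>Re (sum \<epsilon> S)\<bar>"
    using large_subset_sum_real[OF assms, of "\<lambda>i. Re (\<epsilon> i)"] by auto
  moreover obtain T where T: "T \<subseteq> A" "(\<Sum>i\<in>A. \<bar>Im (\<epsilon> i)\<bar>) / 2 \<le> \<bar>Im (sum \<epsilon> T)\<bar>"
    using large_subset_sum_real[OF assms, of "\<lambda>i. Im (\<epsilon> i)"] by auto
  moreover have "\<bar>Re (sum \<epsilon> S)\<bar> \<le> norm (sum \<epsilon> S)" "\<bar>Im (sum \<epsilon> T)\<bar> \<le> norm (sum \<epsilon> T)"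
    by (fact abs_Re_le_cmod abs_Im_le_cmod)+
  ultimately have "(\<Sum>i\<in>A. norm (\<epsilon> i)) / 4 \<le> norm (sum \<epsilon> S) \<or>
      (\<Sum>i\<in>A. norm (\<epsilon> i)) / 4 \<le> norm (sum \<epsilon> T)" by linarith
  thus ?thesis using S(1) T(1) by blast
qed

section \<open>A norm that collapses on blocks centred in gaps\<close>

text \<open>
  \<open>m j\<close> lies at distance at least \<open>h j\<close> from the set \<open>N\<close>. The growth condition on \<open>h\<close> makes level \<open>j\<close>
  negligible on the earlier blocks \<open>{..<m i}\<close>. Level \<open>0\<close>, with an empty block and \<open>h 0 = 1\<close>, provides
  the coordinate functionals.
\<close>
locale gap_blocks =
  fixes m h :: "nat \<Rightarrow> nat" and N :: "nat set"
  assumes m_0: "m 0 = 0" and h_0: "h 0 = 1"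
    and fact_le_h: "fact j \<le> h j"
    and fact_m_le_h: "i < j \<Longrightarrow> fact j * m i \<le> h j"
    and h_le_m: "0 < j \<Longrightarrow> h j \<le> m j"
    and gap: "k \<in> N \<Longrightarrow> k + h j \<le> m j \<or> m j + h j \<le> k"
begin

text \<open>
  Level \<open>j\<close> reaches the value \<open>j!\<close> on sets of \<open>h j\<close> points; the ratio of consecutive values is
  unbounded, so no constant absorbs the loss of one level.
\<close>
definition weight :: "nat \<Rightarrow> real" where
  "weight j = fact j / real (h j)"

text \<open>
  The functional at level \<open>j\<close> given by \<open>S\<close> and \<open>T\<close> is \<open>weight j\<close> times the sum over \<open>S\<close> minus the sum
  over \<open>T\<close>. The last condition makes it vanish on the indicator of the block \<open>{..<m j}\<close>.
\<close>
definition admissible :: "nat \<Rightarrow> nat set \<Rightarrow> nat set \<Rightarrow> bool" where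
  "admissible j S T \<longleftrightarrow> finite S \<and> finite T \<and> card S \<le> h j \<and> card T \<le> h j \<and>
     card (S \<inter> {..<m j}) = card (T \<inter> {..<m j})"

definition encode :: "nat \<Rightarrow> nat set \<Rightarrow> nat set \<Rightarrow> nat" where
  "encode j S T = prod_encode (j, prod_encode (set_encode S, set_encode T))"

text \<open>
  Row \<open>t\<close> holds the coefficients of the functional coded by \<open>t\<close>. The codes of inadmissible triples
  stand for the zero functional, so that every natural number is a code.
\<close>
definition coeff :: "nat \<Rightarrow> nat \<Rightarrow> real" where
  "coeff t i = (case prod_decode t of (j, u) \<Rightarrow> case prod_decode u of (s, r) \<Rightarrow>
     if admissible j (set_decode s) (set_decode r)
     then weight j * (indicator (set_decode s) i - indicator (set_decode r) i) else 0)"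

lemma h_pos: "0 < h j"
  using fact_le_h[of j] fact_gt_zero[of j, where ?'a = nat] by linarith

lemma weight_pos: "0 < weight j"
  by (simp add: weight_def h_pos)

lemma weight_h: "weight j * real (h j) = fact j"
  using h_pos[of j] by (simp add: weight_def)

lemma weight_0: "weight 0 = 1"
  by (simp add: weight_def h_0)

lemma weight_le_1: "weight j \<le> 1"
proof -
  have "(fact j :: real) = real (fact j)" by simp
  also have "\<dots> \<le> real (h j)" by (simp only: of_nat_le_iff fact_le_h)
  finally show ?thesis using h_pos[of j] by (simp add: weight_def)
qed

lemma coeff_encode:
  "admissible j S T \<Longrightarrow> coeff (encode j S T) i = weight j * (indicator S i - indicator T i)"
  unfolding coeff_def encode_def by (auto simp: admissible_def)

lemma coeff_cases:
  obtains (admissible) j S T where "admissible j S T" "t = encode j S T"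
  | (zero) "\<And>i. coeff t i = 0"
proof -
  obtain j u where t: "prod_decode t = (j, u)" by (cases "prod_decode t")
  obtain s r where u: "prod_decode u = (s, r)" by (cases "prod_decode u")
  have "t = encode j (set_decode s) (set_decode r)"
    by (metis encode_def prod_decode_inverse set_decode_inverse t u)
  show thesis
  proof (cases "admissible j (set_decode s) (set_decode r)")
    case True
    thus thesis using \<open>t = encode _ _ _\<close> by (rule admissible)
  next
    case False
    thus thesis by (intro zero) (simp add: coeff_def t u)
  qed
qed

lemma abs_coeff_le: "\<bar>coeff t i\<bar> \<le> 1"
proof (cases t rule: coeff_cases)
  case (admissible j S T)
  thus ?thesis using weight_le_1[of j] weight_pos[of j]
    by (auto simp: coeff_encode indicator_def)
qed simp

text \<open>
  Every functional evaluated at the \<open>i\<close>-th vector: this embeds the example isometrically in \<open>\<ell>\<^sub>\<infinity>\<close>.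
\<close>
definition unit_vector :: "nat \<Rightarrow> (nat \<Rightarrow>\<^sub>C 'k::real_normed_field)" where
  "unit_vector i = Bcontfun (\<lambda>t. of_real (coeff t i))"

lemma apply_unit_vector:
  "apply_bcontfun (unit_vector i) t = (of_real (coeff t i) :: 'k::real_normed_field)"
proof -
  have "(\<lambda>t. of_real (coeff t i) :: 'k) \<in> bcontfun"
    by (rule bcontfun_normI[of _ 1]) (auto simp: abs_coeff_le)
  thus ?thesis by (simp add: unit_vector_def Bcontfun_inverse)
qed

definition coord :: "nat \<Rightarrow> nat" where
  "coord i = encode 0 {i} {}"

lemma coeff_coord: "coeff (coord k) i = (if k = i then 1 else 0)"
proof -
  have "admissible 0 {k} {}" by (simp add: admissible_def m_0 h_0)
  thus ?thesis by (auto simp: coord_def coeff_encode weight_0)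
qed

lemma norm_unit_vector: "norm (unit_vector i :: nat \<Rightarrow>\<^sub>C 'k::real_normed_field) = 1"
proof (rule antisym)
  show "norm (unit_vector i :: nat \<Rightarrow>\<^sub>C 'k) \<le> 1"
    by (rule norm_bound) (simp add: apply_unit_vector abs_coeff_le)
  show "1 \<le> norm (unit_vector i :: nat \<Rightarrow>\<^sub>C 'k)"
    using norm_bounded[of "unit_vector i :: nat \<Rightarrow>\<^sub>C 'k" "coord i"]
    by (simp add: apply_unit_vector coeff_coord)
qed

lemma apply_signed_indicator:
  fixes \<epsilon> :: "nat \<Rightarrow> 'k::{real_normed_field, banach}"
  assumes "finite A" "admissible j S T"
  shows "apply_bcontfun (signed_indicator bc_scale unit_vector \<epsilon> A) (encode j S T) =
    of_real (weight j) * (sum \<epsilon> (A \<inter> S) - sum \<epsilon> (A \<inter> T))"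
proof -
  have "apply_bcontfun (signed_indicator bc_scale unit_vector \<epsilon> A) (encode j S T) =
      (\<Sum>i\<in>A. of_real (weight j) * (indicator S i * \<epsilon> i - indicator T i * \<epsilon> i))"
    unfolding signed_indicator_def apply_bcontfun_sum
    by (rule sum.cong)
       (use assms in \<open>auto simp: apply_bc_scale apply_unit_vector coeff_encode indicator_def\<close>)
  also have "\<dots> = of_real (weight j) * (sum \<epsilon> (A \<inter> S) - sum \<epsilon> (A \<inter> T))"
    using assms(1)
    by (simp add: sum_subtractf indicator_def sum.inter_restrict if_distrib[of "\<lambda>x. x * _"]
      cong: if_cong flip: sum_distrib_left)
  finally show ?thesis .
qed

lemma norm_signed_indicator_le:
  fixes \<epsilon> :: "nat \<Rightarrow> 'k::{real_normed_field, banach}"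
  assumes "finite A" "\<epsilon> \<in> unimodular_on A" "0 \<le> M"
    and bound: "\<And>j S T. admissible j S T \<Longrightarrow>
      weight j * norm (sum \<epsilon> (A \<inter> S) - sum \<epsilon> (A \<inter> T)) \<le> M"
  shows "norm (signed_indicator bc_scale unit_vector \<epsilon> A) \<le> M"
proof (rule norm_bound)
  fix t
  show "norm (apply_bcontfun (signed_indicator bc_scale unit_vector \<epsilon> A) t) \<le> M"
  proof (cases t rule: coeff_cases)
    case (admissible j S T)
    thus ?thesis using bound[OF admissible(1)] weight_pos[of j] assms(1)
      by (simp add: apply_signed_indicator norm_mult)
  next
    case zero
    thus ?thesis using assms(3)
      by (simp add: signed_indicator_def apply_bcontfun_sum apply_bc_scale apply_unit_vector)
  qed
qed

lemma norm_functional_le: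
  fixes \<epsilon> :: "nat \<Rightarrow> 'k::{real_normed_field, banach}"
  assumes "finite A" "\<epsilon> \<in> unimodular_on A" "admissible j S T"
  shows "norm (sum \<epsilon> (A \<inter> S) - sum \<epsilon> (A \<inter> T)) \<le> 2 * real (min (card A) (h j))"
proof -
  have le: "norm (sum \<epsilon> (A \<inter> U)) \<le> real (min (card A) (h j))" if "finite U" "card U \<le> h j" for U
  proof -
    have "norm (sum \<epsilon> (A \<inter> U)) \<le> (\<Sum>i\<in>A \<inter> U. norm (\<epsilon> i))" by (rule norm_sum)
    also have "\<dots> = real (card (A \<inter> U))"
      using assms(2) by (simp add: unimodular_on_def)
    also have "\<dots> \<le> real (min (card A) (h j))"
      using card_mono[OF assms(1), of "A \<inter> U"] card_mono[OF that(1), of "A \<inter> U"] that(2) by simp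
    finally show ?thesis .
  qed
  show ?thesis
    using le[of S] le[of T] assms(3) norm_triangle_ineq4[of "sum \<epsilon> (A \<inter> S)" "sum \<epsilon> (A \<inter> T)"]
    by (simp add: admissible_def)
qed

lemma norm_signed_indicator_ge:
  fixes \<epsilon> :: "nat \<Rightarrow> 'k::{real_normed_field, banach}"
  assumes "finite A" "admissible j S T"
  shows "weight j * norm (sum \<epsilon> (A \<inter> S) - sum \<epsilon> (A \<inter> T))
    \<le> norm (signed_indicator bc_scale unit_vector \<epsilon> A)"
  using norm_bounded[of "signed_indicator bc_scale unit_vector \<epsilon> A" "encode j S T"] weight_pos[of j]
    assms by (simp add: apply_signed_indicator norm_mult)

text \<open>
  The lower estimate for admissible sizes. At least half of \<open>min |B| (h j)\<close> points of \<open>B\<close> lie on one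
  side of the boundary of the block \<open>{..<m j}\<close>. If they lie outside it, any subset of them can serve
  as \<open>S\<close> with \<open>T\<close> empty. If they lie inside, \<open>T\<close> is taken in the block but off \<open>B\<close>, where the gap
  around \<open>m j\<close> leaves room for it, so it contributes nothing. Passing from these points to \<open>S\<close> costs
  the factor \<open>4\<close> of the hypothesis.
\<close>
lemma weight_min_le_norm:
  fixes \<epsilon> :: "nat \<Rightarrow> 'k::{real_normed_field, banach}"
  assumes large_sum: "\<And>A (\<epsilon> :: nat \<Rightarrow> 'k). finite A \<Longrightarrow>
      \<exists>S\<subseteq>A. (\<Sum>i\<in>A. norm (\<epsilon> i)) / 4 \<le> norm (sum \<epsilon> S)"
    and B: "finite B" "\<epsilon> \<in> unimodular_on B" "card B \<in> N"
  shows "weight j * real (min (card B) (h j)) \<le> 8 * norm (signed_indicator bc_scale unit_vector \<epsilon> B)"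
proof -
  let ?I = "{..<m j}"
  have split: "card B = card (B \<inter> ?I) + card (B - ?I)"
    using card_Un_disjoint[of "B \<inter> ?I" "B - ?I"] B(1) by (simp add: Int_Diff_Un Int_Diff_disjoint)
  \<comment> \<open>\<open>P\<close> is the large part of \<open>B\<close> on one side, cut down to at most \<open>h j\<close> points.\<close>
  have "\<exists>P\<subseteq>B. min (card B) (h j) \<le> 2 * card P \<and> card P \<le> h j \<and>
      (P \<inter> ?I = {} \<or> P \<subseteq> ?I \<and> card P \<le> card (?I - B))"
  proof (cases "m j + h j \<le> card B")
    case True
    have "card (B \<inter> ?I) \<le> m j" using card_mono[of ?I "B \<inter> ?I"] by simp
    hence "h j \<le> card (B - ?I)" using True split by linarith
    then obtain P where "P \<subseteq> B - ?I" "card P = h j" by (meson obtain_subset_with_card_n)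
    thus ?thesis by (intro exI[of _ P]) auto
  next
    case False
    hence "card B + h j \<le> m j" using gap B(3) by blast
    moreover have "m j - card B \<le> card (?I - B)" using diff_card_le_card_Diff[OF B(1), of ?I] by simp
    ultimately have room: "h j \<le> card (?I - B)" by linarith
    show ?thesis
    proof (cases "min (card B) (h j) \<le> 2 * card (B - ?I)")
      case True
      obtain P where "P \<subseteq> B - ?I" "card P = min (card (B - ?I)) (h j)"
        by (meson min.cobounded1 obtain_subset_with_card_n)
      thus ?thesis using True by (intro exI[of _ P]) auto
    next
      case False
      obtain P where "P \<subseteq> B \<inter> ?I" "card P = min (card (B \<inter> ?I)) (h j)"
        by (meson min.cobounded1 obtain_subset_with_card_n)
      thus ?thesis using False room split by (intro exI[of _ P]) auto
    qed
  qed
  then obtain P where P: "P \<subseteq> B" "min (card B) (h j) \<le> 2 * card P" "card P \<le> h j"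
    "P \<inter> ?I = {} \<or> P \<subseteq> ?I \<and> card P \<le> card (?I - B)" by blast
  have "finite P" using P(1) B(1) finite_subset by blast
  obtain S where S: "S \<subseteq> P" "(\<Sum>i\<in>P. norm (\<epsilon> i)) / 4 \<le> norm (sum \<epsilon> S)"
    using large_sum[OF \<open>finite P\<close>] by blast
  have "(\<Sum>i\<in>P. norm (\<epsilon> i)) = real (card P)"
    using B(2) P(1) by (simp add: unimodular_on_def subset_iff)
  have fin_S: "finite S" and card_S: "card S \<le> card P"
    using S(1) \<open>finite P\<close> finite_subset card_mono by blast+
  have "\<exists>T. admissible j S T \<and> B \<inter> T = {}"
    using P(4)
  proof
    assume "P \<inter> ?I = {}"
    hence "S \<inter> ?I = {}" using S(1) by blast
    thus ?thesis using fin_S card_S P(3) by (intro exI[of _ "{}"]) (auto simp: admissible_def)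
  next
    assume *: "P \<subseteq> ?I \<and> card P \<le> card (?I - B)"
    hence "card S \<le> card (?I - B)" using card_S by linarith
    then obtain T where T: "T \<subseteq> ?I - B" "card T = card S" by (meson obtain_subset_with_card_n)
    have "S \<inter> ?I = S" "T \<inter> ?I = T" using * S(1) T(1) by blast+
    moreover have "finite T" using T(1) finite_subset by blast
    ultimately show ?thesis
      using T fin_S card_S P(3) by (intro exI[of _ T]) (auto simp: admissible_def)
  qed
  then obtain T where T: "admissible j S T" "B \<inter> T = {}" by blast
  have "B \<inter> S = S" using S(1) P(1) by blast
  have "real (min (card B) (h j)) \<le> real (2 * card P)"
    using P(2) by (simp only: of_nat_le_iff)
  also have "\<dots> \<le> 8 * norm (sum \<epsilon> S)"
    using S(2) \<open>(\<Sum>i\<in>P. norm (\<epsilon> i)) = real (card P)\<close> by simp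
  finally have "weight j * real (min (card B) (h j)) \<le> weight j * (8 * norm (sum \<epsilon> S))"
    using weight_pos[of j] by (intro mult_left_mono) auto
  also have "\<dots> \<le> 8 * norm (signed_indicator bc_scale unit_vector \<epsilon> B)"
    using norm_signed_indicator_ge[OF B(1) T(1), of \<epsilon>] T(2) \<open>B \<inter> S = S\<close> by simp
  finally show ?thesis .
qed

text \<open>
  Upper and lower estimates are compared level by level: at level \<open>j\<close> both are multiples of
  \<open>weight j * min _ (h j)\<close>, which increases with the cardinality.
\<close>
lemma superdemocratic_unit_vector:
  assumes large_sum: "\<And>A (\<epsilon> :: nat \<Rightarrow> 'k::{real_normed_field, banach}). finite A \<Longrightarrow>
      \<exists>S\<subseteq>A. (\<Sum>i\<in>A. norm (\<epsilon> i)) / 4 \<le> norm (sum \<epsilon> S)"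
  shows "superdemocratic (bc_scale :: 'k \<Rightarrow> _) unit_vector N"
proof -
  have "norm (signed_indicator bc_scale unit_vector \<epsilon> A)
      \<le> 16 * norm (signed_indicator bc_scale unit_vector \<epsilon>' B)"
    if A: "finite A" and B: "finite B" and le: "card A \<le> card B" and "card B \<in> N"
      and \<epsilon>: "\<epsilon> \<in> unimodular_on A" and \<epsilon>': "\<epsilon>' \<in> unimodular_on B"
    for A B and \<epsilon> \<epsilon>' :: "nat \<Rightarrow> 'k"
  proof (rule norm_signed_indicator_le[OF A \<epsilon>])
    fix j S T assume adm: "admissible j S T"
    have "norm (sum \<epsilon> (A \<inter> S) - sum \<epsilon> (A \<inter> T)) \<le> 2 * real (min (card A) (h j))"
      by (rule norm_functional_le[OF A \<epsilon> adm])
    also have "\<dots> \<le> 2 * real (min (card B) (h j))" using le by simp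
    finally have "weight j * norm (sum \<epsilon> (A \<inter> S) - sum \<epsilon> (A \<inter> T))
        \<le> weight j * (2 * real (min (card B) (h j)))"
      using weight_pos[of j] by (intro mult_left_mono) auto
    also have "\<dots> \<le> 16 * norm (signed_indicator bc_scale unit_vector \<epsilon>' B)"
      using weight_min_le_norm[OF large_sum B \<epsilon>' \<open>card B \<in> N\<close>, of j] by simp
    finally show "weight j * norm (sum \<epsilon> (A \<inter> S) - sum \<epsilon> (A \<inter> T))
        \<le> 16 * norm (signed_indicator bc_scale unit_vector \<epsilon>' B)" .
  qed simp
  hence "superdemocratic_with (bc_scale :: 'k \<Rightarrow> _) unit_vector N 16"
    unfolding superdemocratic_with_def by simp
  thus ?thesis unfolding superdemocratic_def by blast
qed

lemma sum_unit_vector: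
  "sum unit_vector A = signed_indicator bc_scale unit_vector (\<lambda>_. 1 :: 'k::{real_normed_field, banach}) A"
  by (simp add: signed_indicator_def)

text \<open>
  The levels below \<open>j\<close> contribute at most \<open>2 (j-1)!\<close>, level \<open>j\<close> vanishes, and the levels above have so
  small a weight that even \<open>m j\<close> points cannot make them exceed \<open>2\<close>.
\<close>
lemma norm_block_le:
  assumes "0 < j"
  shows "norm (\<Sum>i<m j. unit_vector i :: nat \<Rightarrow>\<^sub>C 'k::{real_normed_field, banach}) \<le> 2 * fact (j - 1)"
  unfolding sum_unit_vector
proof (rule norm_signed_indicator_le)
  fix i S T assume adm: "admissible i S T"
  let ?v = "norm (sum (\<lambda>_. 1) ({..<m j} \<inter> S) - sum (\<lambda>_. 1) ({..<m j} \<inter> T) :: 'k)"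
  have v: "?v \<le> 2 * real (min (card {..<m j}) (h i))"
    using adm by (intro norm_functional_le) (auto simp: unimodular_on_def)
  consider "i < j" | "i = j" | "j < i" by linarith
  thus "weight i * ?v \<le> 2 * fact (j - 1)"
  proof cases
    assume "i < j"
    have "weight i * ?v \<le> weight i * (2 * real (h i))"
      using v weight_pos[of i] by (intro mult_left_mono) auto
    also have "\<dots> = 2 * fact i" using weight_h[of i] by simp
    also have "\<dots> \<le> 2 * fact (j - 1)" using \<open>i < j\<close> by (simp add: fact_mono)
    finally show ?thesis .
  next
    assume "i = j"
    hence "card ({..<m j} \<inter> S) = card ({..<m j} \<inter> T)"
      using adm by (simp add: admissible_def Int_commute)
    thus ?thesis by simp
  next
    assume "j < i"
    have "fact i * real (m j) = real (fact i * m j)" by simp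
    also have "\<dots> \<le> real (h i)" using fact_m_le_h[OF \<open>j < i\<close>] by (simp only: of_nat_le_iff)
    finally have "weight i * real (m j) \<le> 1" using h_pos[of i] by (simp add: weight_def)
    moreover have "weight i * ?v \<le> weight i * (2 * real (m j))"
      using v weight_pos[of i] by (intro mult_left_mono) auto
    moreover have "(1::real) \<le> fact (j - 1)" by (rule fact_ge_1)
    ultimately show ?thesis by linarith
  qed
qed (auto simp: unimodular_on_def)

lemma fact_le_norm_shifted_block:
  assumes "0 < j"
  shows "fact j \<le> norm (\<Sum>i\<in>{m j..<2 * m j}. unit_vector i :: nat \<Rightarrow>\<^sub>C 'k::{real_normed_field, banach})"
proof -
  let ?A = "{m j..<2 * m j}"
  have "h j \<le> card ?A" using h_le_m[OF assms] by simp
  then obtain S where S: "S \<subseteq> ?A" "card S = h j" by (meson obtain_subset_with_card_n)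
  have "S \<inter> {..<m j} = {}" using S(1) by auto
  hence adm: "admissible j S {}"
    using S finite_subset by (auto simp: admissible_def)
  have "?A \<inter> S = S" using S(1) by blast
  thus ?thesis
    using norm_signed_indicator_ge[OF _ adm, of ?A "\<lambda>_. 1 :: 'k"] S(2) weight_h[of j]
    by (simp add: sum_unit_vector)
qed

lemma not_democratic_unit_vector:
  "\<not> democratic (unit_vector :: nat \<Rightarrow> nat \<Rightarrow>\<^sub>C 'k::{real_normed_field, banach}) {1..}"
proof
  assume "democratic (unit_vector :: nat \<Rightarrow> nat \<Rightarrow>\<^sub>C 'k) {1..}"
  then obtain C where C: "democratic_with (unit_vector :: nat \<Rightarrow> nat \<Rightarrow>\<^sub>C 'k) {1..} C"
    by (auto simp: democratic_def)
  hence "0 < C" by (simp add: democratic_with_def)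
  obtain j :: nat where j: "2 * C < real j" using reals_Archimedean2 by blast
  hence "0 < j" using \<open>0 < C\<close> by (cases j) auto
  have "1 \<le> m j" using h_le_m[OF \<open>0 < j\<close>] h_pos[of j] by linarith
  have "real j * fact (j - 1) = fact j" using \<open>0 < j\<close> by (simp add: fact_reduce)
  also have "\<dots> \<le> norm (\<Sum>i\<in>{m j..<2 * m j}. unit_vector i :: nat \<Rightarrow>\<^sub>C 'k)"
    by (rule fact_le_norm_shifted_block) fact
  also have "\<dots> \<le> C * norm (\<Sum>i<m j. unit_vector i :: nat \<Rightarrow>\<^sub>C 'k)"
  proof -
    have "card {m j..<2 * m j} = m j" "card {..<m j} = m j" by auto
    thus ?thesis using C \<open>1 \<le> m j\<close> unfolding democratic_with_def by (simp del: card_atLeastLessThan)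
  qed
  also have "\<dots> \<le> C * (2 * fact (j - 1))"
    using \<open>0 < C\<close> norm_block_le[OF \<open>0 < j\<close>] by (intro mult_left_mono) auto
  finally have "real j * fact (j - 1) \<le> (2 * C) * fact (j - 1)" by simp
  thus False using j by simp
qed

subsection \<open>The Markushevich basis\<close>

definition spanned_space :: "(nat \<Rightarrow>\<^sub>C 'k::{real_normed_field, banach}) set" where
  "spanned_space = closure (module.span bc_scale (range unit_vector))"

definition coordinate :: "nat \<Rightarrow> (nat \<Rightarrow>\<^sub>C 'k::{real_normed_field, banach}) \<Rightarrow> 'k" where
  "coordinate i x = apply_bcontfun x (coord i)"

lemma coordinate_unit_vector: "coordinate k (unit_vector i) = (if k = i then 1 else 0)"
  by (simp add: coordinate_def apply_unit_vector coeff_coord)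

lemma in_dual_coordinate: "in_dual bc_scale X (coordinate k)"
  unfolding in_dual_def coordinate_def
  by (auto simp: plus_bcontfun.rep_eq apply_bc_scale intro!: exI[of _ 1] norm_bounded)

lemma unit_vector_in_spanned_space: "unit_vector i \<in> spanned_space"
proof -
  have "unit_vector i \<in> module.span bc_scale (range unit_vector)" by (rule bc_scale.span_base) simp
  thus ?thesis unfolding spanned_space_def using closure_subset by blast
qed

lemma basis_unit_vector:
  "basis (bc_scale :: 'k::{real_normed_field, banach} \<Rightarrow> _) spanned_space unit_vector coordinate"
proof -
  have upper: "dual_norm spanned_space (coordinate i :: _ \<Rightarrow> 'k) \<le> 1" for i
    unfolding dual_norm_def
  proof (rule cSUP_least)
    show "spanned_space \<noteq> ({} :: (nat \<Rightarrow>\<^sub>C 'k) set)" using unit_vector_in_spanned_space by blast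
    fix x :: "nat \<Rightarrow>\<^sub>C 'k"
    show "norm (coordinate i x) / norm x \<le> 1"
      by (simp add: coordinate_def norm_bounded divide_le_eq_1)
  qed
  have lower: "1 \<le> dual_norm spanned_space (coordinate i :: _ \<Rightarrow> 'k)" for i
    using dual_norm_bounds(2)[OF in_dual_coordinate unit_vector_in_spanned_space, of i i]
    by (simp add: coordinate_unit_vector norm_unit_vector)
  have "dual_norm spanned_space (coordinate i :: _ \<Rightarrow> 'k) = 1" for i
    using upper lower by (rule antisym)
  thus ?thesis
    unfolding basis_def
    by (simp add: in_dual_coordinate coordinate_unit_vector norm_unit_vector)
       (simp add: spanned_space_def)
qed

text \<open>
  Every functional of the family is a finite combination of coordinates on the basis vectors, hence
  by linearity and continuity on the whole space. So a vector is determined by its coordinates.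
\<close>
lemma apply_eq_sum_coordinates:
  fixes x :: "nat \<Rightarrow>\<^sub>C 'k::{real_normed_field, banach}"
  assumes "x \<in> spanned_space"
  shows "\<exists>U. finite U \<and> apply_bcontfun x t = (\<Sum>i\<in>U. of_real (coeff t i) * coordinate i x)"
proof -
  obtain U where U: "finite U" "\<And>i. i \<notin> U \<Longrightarrow> coeff t i = 0"
  proof (cases t rule: coeff_cases)
    case (admissible j S T)
    thus thesis using that[of "S \<union> T"]
      by (auto simp: coeff_encode) (auto simp: admissible_def)
  next
    case zero
    thus thesis using that[of "{}"] by simp
  qed
  define Y where "Y = {x :: nat \<Rightarrow>\<^sub>C 'k. apply_bcontfun x t = (\<Sum>i\<in>U. of_real (coeff t i) * coordinate i x)}"
  have "closed Y"
    unfolding Y_def coordinate_def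
    by (intro closed_Collect_eq continuous_intros continuous_on_evaluation)
  moreover have "module.span bc_scale (range unit_vector) \<subseteq> Y"
  proof (rule bc_scale.span_minimal)
    show "range unit_vector \<subseteq> Y"
      using U by (auto simp: Y_def apply_unit_vector coordinate_unit_vector if_distrib cong: if_cong)
    show "module.subspace bc_scale Y"
      by (rule bc_scale.subspaceI)
         (auto simp: Y_def coordinate_def zero_bcontfun.rep_eq plus_bcontfun.rep_eq apply_bc_scale
           algebra_simps sum.distrib sum_distrib_left)
  qed
  ultimately have "spanned_space \<subseteq> Y"
    unfolding spanned_space_def by (rule closure_minimal[rotated])
  thus ?thesis using assms U(1) unfolding Y_def by blast
qed

lemma markushevich_basis_unit_vector:
  "markushevich_basis (bc_scale :: 'k::{real_normed_field, banach} \<Rightarrow> _) spanned_space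
    unit_vector coordinate"
proof -
  have "x = 0" if "x \<in> spanned_space" "\<forall>i. coordinate i x = 0" for x :: "nat \<Rightarrow>\<^sub>C 'k"
  proof (rule bcontfun_eqI)
    show "apply_bcontfun x t = apply_bcontfun 0 t" for t
      using apply_eq_sum_coordinates[OF that(1), of t] that(2) by (auto simp: zero_bcontfun.rep_eq)
  qed
  thus ?thesis using basis_unit_vector by (auto simp: markushevich_basis_def)
qed

lemma banach_space_spanned_space:
  "banach_space_over (bc_scale :: 'k::{real_normed_field, banach, second_countable_topology} \<Rightarrow> _)
    spanned_space"
proof -
  let ?E = "range unit_vector :: (nat \<Rightarrow>\<^sub>C 'k) set"
  have inj: "inj (unit_vector :: nat \<Rightarrow> nat \<Rightarrow>\<^sub>C 'k)"
    by (rule injI) (metis coordinate_unit_vector zero_neq_one)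
  have "bc_scale.independent ?E"
    unfolding bc_scale.independent_explicit_module
  proof (intro allI impI)
    fix V :: "(nat \<Rightarrow>\<^sub>C 'k) set" and a v
    assume V: "finite V" "V \<subseteq> ?E" "(\<Sum>v\<in>V. bc_scale (a v) v) = 0" "v \<in> V"
    obtain k where k: "v = unit_vector k" using V by blast
    have "0 = coordinate k (\<Sum>v\<in>V. bc_scale (a v) v)" using V(3)
      by (simp add: coordinate_def zero_bcontfun.rep_eq)
    also have "\<dots> = (\<Sum>u\<in>V. a u * coordinate k u)"
      by (simp add: coordinate_def apply_bcontfun_sum apply_bc_scale)
    also have "\<dots> = (\<Sum>u\<in>V. if u = v then a v else 0)"
      by (rule sum.cong) (use V(2) k inj in \<open>auto simp: coordinate_unit_vector inj_eq\<close>)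
    finally show "a v = 0" using V by simp
  qed
  hence "\<not> ?E \<subseteq> module.span bc_scale F" if "finite F" for F
    using bc_scale.independent_span_bound[OF that] inj range_inj_infinite by blast
  hence "\<not> (\<exists>F. finite F \<and> (spanned_space :: (nat \<Rightarrow>\<^sub>C 'k) set) \<subseteq> module.span bc_scale F)"
    using unit_vector_in_spanned_space by blast
  moreover have "module.subspace bc_scale (spanned_space :: (nat \<Rightarrow>\<^sub>C 'k) set)"
    unfolding spanned_space_def by (intro bc_scale.subspace_closure bc_scale.subspace_span)
  moreover have "normed_scaling (bc_scale :: 'k \<Rightarrow> (nat \<Rightarrow>\<^sub>C 'k) \<Rightarrow> _)" ..
  ultimately show ?thesis
    unfolding banach_space_over_def
    using separable_closure_span[of "bc_scale :: 'k \<Rightarrow> (nat \<Rightarrow>\<^sub>C 'k) \<Rightarrow> _" unit_vector]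
    by (auto simp: spanned_space_def)
qed

end

section \<open>Large gaps\<close>

text \<open>
  The midpoint of a gap of length at least \<open>2 H\<close>.
\<close>
lemma gap_centre:
  assumes n: "sequence_with_gaps n" and gaps: "arbitrarily_large_additive_gaps n"
  shows "\<exists>m. H \<le> m \<and> (\<forall>k\<in>range n. k + H \<le> m \<or> m + H \<le> k)"
proof -
  have mono: "strict_mono n" using n by (simp add: sequence_with_gaps_def)
  have "\<exists>k. 2 * real H \<le> real (n (Suc k)) - real (n k)"
  proof (rule ccontr)
    assume "\<not> ?thesis"
    hence "limsup (\<lambda>k. ereal (real (n (Suc k)) - real (n k))) \<le> ereal (2 * real H)"
      by (intro Limsup_bounded always_eventually) (auto simp: not_le less_imp_le)
    thus False using gaps by (simp add: arbitrarily_large_additive_gaps_def)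
  qed
  then obtain k where "2 * real H \<le> real (n (Suc k)) - real (n k)" by blast
  hence k: "n k + 2 * H \<le> n (Suc k)" by linarith
  have "n i + H \<le> n k + H \<or> n k + H + H \<le> n i" for i
  proof (cases "i \<le> k")
    case True
    thus ?thesis using mono by (simp add: strict_mono_less_eq)
  next
    case False
    hence "n (Suc k) \<le> n i" using mono by (simp add: strict_mono_less_eq)
    thus ?thesis using k by linarith
  qed
  thus ?thesis by (intro exI[of _ "n k + H"]) auto
qed

text \<open>
  \<open>h (j + 1)\<close> is chosen after \<open>m j\<close>, and \<open>m (j + 1)\<close> is then the centre of a gap of length at
  least \<open>2 * h (j + 1)\<close>. Since \<open>m\<close> increases, dominating \<open>m j\<close> dominates all earlier blocks.
\<close>
lemma gap_blocks_exist:
  assumes n: "sequence_with_gaps n" and gaps: "arbitrarily_large_additive_gaps n"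
  obtains m h where "gap_blocks m h (range n)"
proof -
  obtain c where c: "\<And>H. H \<le> c H" "\<And>H k. k \<in> range n \<Longrightarrow> k + H \<le> c H \<or> c H + H \<le> k"
    using gap_centre[OF n gaps] by metis
  define m where "m = rec_nat 0 (\<lambda>j mj. c (fact (Suc j) * Suc mj))"
  define h where "h j = (case j of 0 \<Rightarrow> 1 | Suc i \<Rightarrow> fact (Suc i) * Suc (m i))" for j
  have m_Suc: "m (Suc j) = c (h (Suc j))" for j
    by (simp add: m_def h_def)
  have h_Suc: "h (Suc j) = fact (Suc j) * Suc (m j)" for j
    by (simp add: h_def)
  have h_le: "h (Suc j) \<le> m (Suc j)" for j using c(1) m_Suc by simp
  have "m j \<le> m (Suc j)" for j
  proof -
    have "1 * Suc (m j) \<le> fact (Suc j) * Suc (m j)" by (intro mult_le_mono1 fact_ge_1)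
    hence "Suc (m j) \<le> h (Suc j)" unfolding h_Suc by (simp only: mult_1)
    thus ?thesis using h_le[of j] by linarith
  qed
  hence mono: "m i \<le> m j" if "i \<le> j" for i j using that by (rule lift_Suc_mono_le)
  have "gap_blocks m h (range n)"
  proof
    show "m 0 = 0" "h 0 = 1" by (simp_all add: m_def h_def)
    show "fact j \<le> h j" for j by (cases j) (simp_all add: h_def)
    show "fact j * m i \<le> h j" if "i < j" for i j
    proof -
      obtain k where k: "j = Suc k" using \<open>i < j\<close> by (cases j) auto
      hence "m i \<le> Suc (m k)" using mono[of i k] that by simp
      thus ?thesis unfolding k h_Suc by (rule mult_le_mono2)
    qed
    show "h j \<le> m j" if "0 < j" for j using that h_le by (cases j) auto
    show "k + h j \<le> m j \<or> m j + h j \<le> k" if "k \<in> range n" for k j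
    proof (cases j)
      case 0
      thus ?thesis using that n by (auto simp: sequence_with_gaps_def m_def h_def Suc_leI)
    next
      case (Suc i)
      thus ?thesis using c(2)[OF that] m_Suc by simp
    qed
  qed
  thus thesis by (rule that)
qed

lemma superdemocratic_not_democratic_example:
  assumes "sequence_with_gaps n" "arbitrarily_large_additive_gaps n"
    and large_sum: "\<And>A (\<epsilon> :: nat \<Rightarrow> 'k::{real_normed_field, banach, second_countable_topology}).
      finite A \<Longrightarrow> \<exists>S\<subseteq>A. (\<Sum>i\<in>A. norm (\<epsilon> i)) / 4 \<le> norm (sum \<epsilon> S)"
  shows "\<exists>(sc :: 'k \<Rightarrow> (nat \<Rightarrow>\<^sub>C 'k) \<Rightarrow> (nat \<Rightarrow>\<^sub>C 'k)) X e es.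
    banach_space_over sc X \<and> markushevich_basis sc X e es \<and>
    superdemocratic sc e (range n) \<and> \<not> democratic e {1..}"
proof -
  obtain m h where "gap_blocks m h (range n)" using gap_blocks_exist assms(1,2) by blast
  then interpret gap_blocks m h "range n" .
  show ?thesis
    using banach_space_spanned_space markushevich_basis_unit_vector
      superdemocratic_unit_vector[OF large_sum] not_democratic_unit_vector by blast
qed

section \<open>Superdemocracy along sequences with gaps\<close>

theorem proposition3p8:
  fixes n :: "nat \<Rightarrow> nat"
  assumes "sequence_with_gaps n"
  shows "(arbitrarily_large_additive_gaps n \<longrightarrow>
        (\<exists>(sc :: real \<Rightarrow> (nat \<Rightarrow>\<^sub>C real) \<Rightarrow> (nat \<Rightarrow>\<^sub>C real)) X e es.
           banach_space_over sc X \<and> markushevich_basis sc X e es \<and>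
           superdemocratic sc e (range n) \<and> \<not> democratic e {1..})) \<and>
    (arbitrarily_large_additive_gaps n \<longrightarrow>
        (\<exists>(sc :: complex \<Rightarrow> (nat \<Rightarrow>\<^sub>C complex) \<Rightarrow> (nat \<Rightarrow>\<^sub>C complex)) X e es.
           banach_space_over sc X \<and> markushevich_basis sc X e es \<and>
           superdemocratic sc e (range n) \<and> \<not> democratic e {1..})) \<and>
    (\<forall>l \<Delta> (sc :: real \<Rightarrow> 'a::banach \<Rightarrow> 'a) X e es.
         2 \<le> l \<longrightarrow> bounded_additive_gaps l n \<longrightarrow>
         banach_space_over sc X \<longrightarrow> basis sc X e es \<longrightarrow>
         const_superdemocratic \<Delta> sc e (range n) \<longrightarrow>
         (\<exists>C. const_superdemocratic C sc e {1..} \<and>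
            C \<le> max (real (n 0) * alpha1 e * alpha2 X es)
                  (\<Delta> * (1 + real l * alpha1 e * alpha2 X es) + real l * alpha1 e * alpha2 X es))) \<and>
    (\<forall>l \<Delta> (sc :: complex \<Rightarrow> 'a::banach \<Rightarrow> 'a) X e es.
         2 \<le> l \<longrightarrow> bounded_additive_gaps l n \<longrightarrow>
         banach_space_over sc X \<longrightarrow> basis sc X e es \<longrightarrow>
         const_superdemocratic \<Delta> sc e (range n) \<longrightarrow>
         (\<exists>C. const_superdemocratic C sc e {1..} \<and>
            C \<le> max (real (n 0) * alpha1 e * alpha2 X es)
                  (\<Delta> * (1 + real l * alpha1 e * alpha2 X es) + real l * alpha1 e * alpha2 X es))) \<and>
    (\<forall>l \<Delta> (sc :: real \<Rightarrow> 'a::banach \<Rightarrow> 'a) X e es.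
         2 \<le> l \<longrightarrow> bounded_additive_gaps l n \<longrightarrow>
         banach_space_over sc X \<longrightarrow> basis sc X e es \<longrightarrow>
         const_democratic \<Delta> e (range n) \<longrightarrow>
         (\<exists>C. const_democratic C e {1..} \<and>
            C \<le> max ((real (n 0) - 1) * alpha1 e * alpha2 X es)
                  (\<Delta> * (1 + real l * alpha1 e * alpha2 X es) + real l * alpha1 e * alpha2 X es))) \<and>
    (\<forall>l \<Delta> (sc :: complex \<Rightarrow> 'a::banach \<Rightarrow> 'a) X e es.
         2 \<le> l \<longrightarrow> bounded_additive_gaps l n \<longrightarrow>
         banach_space_over sc X \<longrightarrow> basis sc X e es \<longrightarrow>
         const_democratic \<Delta> e (range n) \<longrightarrow>
         (\<exists>C. const_democratic C e {1..} \<and>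
            C \<le> max ((real (n 0) - 1) * alpha1 e * alpha2 X es)
                  (\<Delta> * (1 + real l * alpha1 e * alpha2 X es) + real l * alpha1 e * alpha2 X es)))"
proof (intro conjI impI allI)
  have real_sum: "\<exists>S\<subseteq>A. (\<Sum>i\<in>A. norm (\<epsilon> i)) / 4 \<le> norm (sum \<epsilon> S)"
    if "finite A" for A :: "nat set" and \<epsilon> :: "nat \<Rightarrow> real"
  proof -
    obtain S where "S \<subseteq> A" "(\<Sum>i\<in>A. \<bar>\<epsilon> i\<bar>) / 2 \<le> \<bar>sum \<epsilon> S\<bar>"
      using large_subset_sum_real[OF \<open>finite A\<close>] by blast
    moreover have "0 \<le> (\<Sum>i\<in>A. \<bar>\<epsilon> i\<bar>)" by (simp add: sum_nonneg)
    ultimately show ?thesis by (intro exI[of _ S]) simp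
  qed
  assume "arbitrarily_large_additive_gaps n"
  note example = superdemocratic_not_democratic_example[OF assms this]
  show "\<exists>(sc :: real \<Rightarrow> (nat \<Rightarrow>\<^sub>C real) \<Rightarrow> (nat \<Rightarrow>\<^sub>C real)) X e es.
      banach_space_over sc X \<and> markushevich_basis sc X e es \<and>
      superdemocratic sc e (range n) \<and> \<not> democratic e {1..}"
    by (rule example[OF real_sum])
  show "\<exists>(sc :: complex \<Rightarrow> (nat \<Rightarrow>\<^sub>C complex) \<Rightarrow> (nat \<Rightarrow>\<^sub>C complex)) X e es.
      banach_space_over sc X \<and> markushevich_basis sc X e es \<and>
      superdemocratic sc e (range n) \<and> \<not> democratic e {1..}"
    by (rule example[OF large_subset_sum_complex])
qed (rule superdemocratic_of_bounded_gaps[OF _ _ assms] democratic_of_bounded_gaps[OF _ _ assms];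
    assumption)+

end
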